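(* Let $\Sigma$ be a finite nonempty alphabet, $L\subseteq\Sigma^*$ and $\kappa(L)=n>1$. If $L$ is a two-sided ideal or a factor-closed language, then $\sigma(L)\le n^{n-2}+(n-2)2^{n-2}+1$. This bound is tight: for $n=2$ whenever $|\Sigma|\ge 2$, for $n=3$ whenever $|\Sigma|\ge 3$, for $n=4$ whenever $|\Sigma|\ge 5$, and for $n\ge 5$ whenever $|\Sigma|\ge 6$, there is a language over $\Sigma$ of the respective type with $\kappa(L)=n$ attaining the bound. Moreover, these alphabet sizes cannot be reduced.
   Context: For $L\subseteq\Sigma^*$ and $w\in\Sigma^*$, $w^{-1}L=\{x: wx\in L\}$; $\kappa(L)$ is the number of distinct such quotients (the number of states of a minimal DFA of $L$). The syntactic congruence: $x\approx_L y$ iff for all $u,v\in\Sigma^*$, $uxv\in L\Leftrightarrow uyv\in L$; $\sigma(L)$ is the cardinality of the syntactic semigroup $\Sigma^+/\approx_L$ (equivalently, of the transition semigroup of a minimal DFA of $L$). $L$ is a two-sided ideal if it is nonempty and $L=\Sigma^*L\Sigma^*$; $L$ is factor-closed if $w\in L$ implies every factor $x$ of $w$ (i.e. $w=uxv$) is in $L$. *)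

theory Defs
  imports Main
begin

text \<open>Languages over an explicit alphabet Sigma = A (a set of letters of type 'a);
  words are lists, Sigma^* is lists A.\<close>

definition quotient_lang :: "'a list \<Rightarrow> 'a list set \<Rightarrow> 'a list set" where
  "quotient_lang w L = {x. w @ x \<in> L}"

definition kappa :: "'a set \<Rightarrow> 'a list set \<Rightarrow> nat" where
  "kappa A L = card {quotient_lang w L | w. w \<in> lists A}"

definition syn_cong :: "'a set \<Rightarrow> 'a list set \<Rightarrow> ('a list \<times> 'a list) set" where
  "syn_cong A L = {(x, y). x \<in> lists A \<and> y \<in> lists A \<and>
     (\<forall>u \<in> lists A. \<forall>v \<in> lists A. u @ x @ v \<in> L \<longleftrightarrow> u @ y @ v \<in> L)}"

definition sigma :: "'a set \<Rightarrow> 'a list set \<Rightarrow> nat" where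
  "sigma A L = card ((lists A - {[]}) // syn_cong A L)"

definition two_sided_ideal :: "'a set \<Rightarrow> 'a list set \<Rightarrow> bool" where
  "two_sided_ideal A L \<longleftrightarrow> L \<noteq> {} \<and>
     L = {u @ w @ v | u w v. u \<in> lists A \<and> w \<in> L \<and> v \<in> lists A}"

definition factor_closed :: "'a list set \<Rightarrow> bool" where
  "factor_closed L \<longleftrightarrow> (\<forall>w \<in> L. \<forall>u x v. w = u @ x @ v \<longrightarrow> x \<in> L)"

definition sigma_bound :: "nat \<Rightarrow> nat" where
  "sigma_bound n = n ^ (n - 2) + (n - 2) * 2 ^ (n - 2) + 1"

definition min_alpha :: "nat \<Rightarrow> nat" where
  "min_alpha n = (if n = 2 then 2 else if n = 3 then 3 else if n = 4 then 5 else 6)"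

end

theory Submission
  imports Defs Complex_Main "HOL-Library.FuncSet" "HOL-Combinatorics.Cycles"
begin

text \<open>A factor-closed language with more than one quotient is the complement of a two-sided ideal,
  and complementation changes neither \<open>kappa\<close> nor \<open>sigma\<close>, so only ideals matter. Order the \<open>n\<close>
  quotients of an ideal \<open>L\<close> by inclusion: \<open>L\<close> is the least one, \<open>lists A\<close> the greatest, and every word
  acts as a monotone map fixing the top. If the \<open>n - 2\<close> middle quotients form an antichain, a
  monotone map either fixes the bottom, or sends it to some \<open>i\<close> and everything else to \<open>i\<close> or the
  top; these maps (\<open>maxmaps\<close>) number exactly \<open>sigma_bound n\<close>. If \<open>x < y\<close> are middle quotients, the
  condition \<open>f x \<le> f y\<close> alone already about halves the number of maps with a given value \<open>i\<close> at
  the bottom, and summing over \<open>i\<close> along a linear extension stays strictly below the bound.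

  Hence equality forces the transition semigroup to be all of \<open>maxmaps\<close>. Its generators must include
  generators of the permutations of the middle states, one map for each of the three ways of merging
  a single pair of states (middle with bottom, top or middle), and one map moving the bottom.
  Conversely such maps generate \<open>maxmaps\<close>, and the automaton on \<open>n\<close> states
  with these letters recognizes an ideal attaining the bound.\<close>

section \<open>Automata and syntactic complexity\<close>

lemma quotient_lang_append: "quotient_lang v (quotient_lang u L) = quotient_lang (u @ v) L"
  by (simp add: quotient_lang_def)

lemma quotient_lang_Nil [simp]: "quotient_lang [] L = L"
  by (simp add: quotient_lang_def)

lemma quotient_lang_subset: "w \<in> lists A \<Longrightarrow> L \<subseteq> lists A \<Longrightarrow> quotient_lang w L \<subseteq> lists A"
  by (force simp: quotient_lang_def)

text \<open>Classes are formed in \<open>X\<close>, but only those of members of \<open>S\<close>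
  are counted. With nonempty words inside all words, a class may also contain the empty word without
  altering the count.\<close>

lemma card_quotient_eq_card_image:
  assumes "S \<subseteq> X" and r: "r = {(x, y). x \<in> X \<and> y \<in> X \<and> f x = f y}"
  shows "card (S // r) = card (f ` S)"
proof -
  let ?g = "\<lambda>t. {y \<in> X. f y = t}"
  have "S // r = ?g ` f ` S"
    using assms by (fastforce simp: quotient_def)
  moreover have "inj_on ?g (f ` S)"
    using assms(1) by (fastforce simp: inj_on_def)
  ultimately show ?thesis
    by (simp add: card_image)
qed

text \<open>A reachable deterministic automaton with pairwise inequivalent states, given by the
  action of words on the state set and by the language accepted from each state.\<close>

locale minimal_dfa =
  fixes A :: "'a set" and L :: "'a list set" and Q :: "'s set" and s0 :: 's
    and run :: "'a list \<Rightarrow> 's \<Rightarrow> 's" and lang :: "'s \<Rightarrow> 'a list set"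
  assumes L_subset: "L \<subseteq> lists A"
    and Q_eq: "Q = (\<lambda>w. run w s0) ` lists A"
    and lang_s0: "lang s0 = L"
    and lang_run: "\<And>w q. w \<in> lists A \<Longrightarrow> q \<in> Q \<Longrightarrow> lang (run w q) = quotient_lang w (lang q)"
    and inj_lang: "inj_on lang Q"
    and run_Nil: "\<And>q. run [] q = q"
    and run_append: "\<And>u v q. run (u @ v) q = run v (run u q)"
begin

definition trans :: "'a list \<Rightarrow> 's \<Rightarrow> 's" where
  "trans w = restrict (run w) Q"

lemma s0_in_Q: "s0 \<in> Q"
  unfolding Q_eq by (rule image_eqI[of _ _ "[]"]) (auto simp: run_Nil)

lemma run_in_Q: "w \<in> lists A \<Longrightarrow> q \<in> Q \<Longrightarrow> run w q \<in> Q"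
  unfolding Q_eq by (force simp: run_append[symmetric])

lemma kappa_eq: "kappa A L = card Q"
proof -
  have "{quotient_lang w L | w. w \<in> lists A} = lang ` Q"
  proof -
    have "lang ` Q = (\<lambda>w. lang (run w s0)) ` lists A"
      by (subst Q_eq) (simp add: image_image)
    also have "\<dots> = (\<lambda>w. quotient_lang w L) ` lists A"
      by (rule image_cong) (simp_all add: lang_run s0_in_Q lang_s0)
    finally show ?thesis by blast
  qed
  then show ?thesis
    by (simp add: kappa_def card_image inj_lang)
qed

text \<open>For fixed \<open>u\<close>, testing all \<open>v\<close> compares the languages of two
  states, and \<open>inj_lang\<close> turns equal languages into equal states. Every state is
  reached by some \<open>u\<close>, so all \<open>u\<close> together test all of
  \<open>Q\<close>.\<close>

lemma syn_cong_eq: "syn_cong A L = {(x, y). x \<in> lists A \<and> y \<in> lists A \<and> trans x = trans y}"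
proof -
  have "(\<forall>u\<in>lists A. \<forall>v\<in>lists A. u @ x @ v \<in> L \<longleftrightarrow> u @ y @ v \<in> L) \<longleftrightarrow> trans x = trans y"
    if x: "x \<in> lists A" and y: "y \<in> lists A" for x y
  proof -
    have "(\<forall>v\<in>lists A. u @ x @ v \<in> L \<longleftrightarrow> u @ y @ v \<in> L) \<longleftrightarrow>
        run x (run u s0) = run y (run u s0)" if u: "u \<in> lists A" for u
    proof -
      have uQ: "run u s0 \<in> Q" using u s0_in_Q run_in_Q by blast
      have q: "lang (run x (run u s0)) = quotient_lang (u @ x) L" if "x \<in> lists A" for x
        using that u uQ s0_in_Q by (simp add: lang_run lang_s0 quotient_lang_append)
      have "run x (run u s0) = run y (run u s0) \<longleftrightarrow>
          lang (run x (run u s0)) = lang (run y (run u s0))"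
        using inj_lang run_in_Q uQ x y by (metis inj_onD)
      also have "\<dots> \<longleftrightarrow> quotient_lang (u @ x) L = quotient_lang (u @ y) L"
        using x y by (simp add: q)
      \<comment> \<open>Words outside \<open>lists A\<close> lie in neither quotient by
        \<open>L_subset\<close>, so restricting \<open>v\<close> loses nothing.\<close>
      also have "\<dots> \<longleftrightarrow> (\<forall>v\<in>lists A. u @ x @ v \<in> L \<longleftrightarrow> u @ y @ v \<in> L)"
        using L_subset by (force simp: quotient_lang_def set_eq_iff)
      finally show ?thesis by simp
    qed
    moreover have "trans x = trans y \<longleftrightarrow> (\<forall>q\<in>Q. run x q = run y q)"
      by (auto simp: trans_def fun_eq_iff restrict_def)
    ultimately show ?thesis
      by (simp add: Q_eq)
  qed
  then show ?thesis
    unfolding syn_cong_def by blast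
qed

lemma sigma_eq: "sigma A L = card (trans ` (lists A - {[]}))"
  unfolding sigma_def by (rule card_quotient_eq_card_image[OF _ syn_cong_eq]) blast

end

text \<open>This is the Myhill-Nerode automaton: each quotient is a state whose language is
  itself.\<close>

lemma minimal_dfa_quotients:
  assumes "L \<subseteq> lists A"
  shows "minimal_dfa A L ((\<lambda>w. quotient_lang w L) ` lists A) L quotient_lang (\<lambda>K. K)"
  using assms by unfold_locales (simp_all add: quotient_lang_append)

section \<open>Complements exchange ideals and factor-closed languages\<close>

lemma two_sided_ideal_mult:
  assumes "two_sided_ideal A L" "u \<in> lists A" "w \<in> L" "v \<in> lists A"
  shows "u @ w @ v \<in> L"
  using assms unfolding two_sided_ideal_def by blast

text \<open>Not being in \<open>L\<close> passes from a factor to the whole word. The bound on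
  \<open>kappa\<close> excludes \<open>L = lists A\<close>, whose complement is empty and hence no
  ideal.\<close>

lemma two_sided_ideal_compl:
  assumes "L \<subseteq> lists A" "factor_closed L" "kappa A L > 1"
  shows "two_sided_ideal A (lists A - L)"
proof -
  have "lists A - L \<noteq> {}"
  proof
    assume "lists A - L = {}"
    then have "L = lists A" using assms(1) by blast
    then have "quotient_lang w L = lists A" if "w \<in> lists A" for w
      using that by (auto simp: quotient_lang_def)
    then have "{quotient_lang w L | w. w \<in> lists A} \<subseteq> {lists A}" by auto
    then have "kappa A L \<le> 1"
      unfolding kappa_def using card_mono[of "{lists A}"] by simp
    with assms(3) show False by simp
  qed
  moreover have "lists A - L = {u @ w @ v |u w v. u \<in> lists A \<and> w \<in> lists A - L \<and> v \<in> lists A}"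
    (is "_ = ?R")
  proof
    show "lists A - L \<subseteq> ?R"
    proof
      fix w assume "w \<in> lists A - L"
      then have "w = [] @ w @ [] \<and> [] \<in> lists A \<and> w \<in> lists A - L \<and> [] \<in> lists A" by simp
      then show "w \<in> ?R" by blast
    qed
    show "?R \<subseteq> lists A - L"
      using assms(2) unfolding factor_closed_def by auto
  qed
  ultimately show ?thesis
    unfolding two_sided_ideal_def by blast
qed

lemma factor_closed_compl:
  assumes "two_sided_ideal A L"
  shows "factor_closed (lists A - L)"
  unfolding factor_closed_def
proof (intro ballI allI impI)
  fix w u x v assume w: "w \<in> lists A - L" "w = u @ x @ v"
  then have "u \<in> lists A" "x \<in> lists A" "v \<in> lists A" by auto
  then show "x \<in> lists A - L" using two_sided_ideal_mult[OF assms] w by blast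
qed

lemma kappa_compl:
  assumes "L \<subseteq> lists A"
  shows "kappa A (lists A - L) = kappa A L"
proof -
  let ?c = "\<lambda>K. lists A - K"
  have q: "quotient_lang w (lists A - L) = ?c (quotient_lang w L)" if "w \<in> lists A" for w
    using that by (auto simp: quotient_lang_def)
  have "{quotient_lang w (lists A - L) | w. w \<in> lists A}
      = ?c ` {quotient_lang w L | w. w \<in> lists A}"
    using q by blast
  moreover have "inj_on ?c {quotient_lang w L | w. w \<in> lists A}"
  proof (rule inj_onI)
    fix x y
    assume "x \<in> {quotient_lang w L | w. w \<in> lists A}" "y \<in> {quotient_lang w L | w. w \<in> lists A}"
      and eq: "?c x = ?c y"
    then have "x \<subseteq> lists A" "y \<subseteq> lists A"
      using quotient_lang_subset[OF _ assms] by auto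
    with eq show "x = y" by blast
  qed
  ultimately show ?thesis
    by (simp add: kappa_def card_image)
qed

lemma sigma_compl: "sigma A (lists A - L) = sigma A L"
proof -
  have "syn_cong A (lists A - L) = syn_cong A L"
    unfolding syn_cong_def by fastforce
  then show ?thesis
    by (simp add: sigma_def)
qed

section \<open>Monotone maps on a bounded poset\<close>

definition maxmaps :: "'s set \<Rightarrow> 's \<Rightarrow> 's \<Rightarrow> ('s \<Rightarrow> 's) set" where
  "maxmaps Q b z = {f \<in> Q \<rightarrow>\<^sub>E Q. f z = z \<and> (f b = b \<or> (\<forall>q\<in>Q. f q \<in> {f b, z}))}"

lemma prod_two_special:
  fixes c d e :: nat
  assumes "finite Q" "b \<in> Q" "z \<in> Q" "b \<noteq> z"
  shows "(\<Prod>q\<in>Q. if q = b then c else if q = z then d else e) = c * d * e ^ (card Q - 2)"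
proof -
  have Q: "Q = insert b (insert z (Q - {b, z}))" using assms by blast
  have "(\<Prod>q\<in>Q. if q = b then c else if q = z then d else e)
      = c * (d * (\<Prod>q\<in>Q - {b, z}. if q = b then c else if q = z then d else e))"
    by (subst Q) (use assms in auto)
  also have "(\<Prod>q\<in>Q - {b, z}. if q = b then c else if q = z then d else e) = (\<Prod>q\<in>Q - {b, z}. e)"
    by (rule prod.cong) auto
  also have "\<dots> = e ^ (card Q - 2)"
    using assms by (simp add: card_Diff_subset numeral_2_eq_2)
  finally show ?thesis by simp
qed

text \<open>The summands count the maps with \<open>f b = b\<close> (middle points are free), with
  \<open>f b\<close> a middle point \<open>i\<close> (each middle point goes to \<open>i\<close> or
  \<open>z\<close>), and with \<open>f b = z\<close> (only the constant map).\<close>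

lemma card_maxmaps:
  assumes "finite Q" "b \<in> Q" "z \<in> Q" "b \<noteq> z"
  shows "card (maxmaps Q b z) = sigma_bound (card Q)"
proof -
  define F where "F = (\<lambda>i. PiE Q (\<lambda>q. if q = b then {i} else if q = z then {z} else {i, z}))"
  define G where "G = PiE Q (\<lambda>q. if q = b then {b} else if q = z then {z} else Q)"
  let ?n = "card Q"
  have eq: "maxmaps Q b z = G \<union> (\<Union>i\<in>Q - {b}. F i)"
  proof (intro set_eqI iffI)
    fix f assume f: "f \<in> maxmaps Q b z"
    then have fb: "f b \<in> Q" using assms by (auto simp: maxmaps_def)
    show "f \<in> G \<union> (\<Union>i\<in>Q - {b}. F i)"
    proof (cases "f b = b")
      case True
      then have "f \<in> G" using f by (auto simp: maxmaps_def G_def PiE_iff)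
      then show ?thesis by blast
    next
      case False
      then have "f \<in> F (f b)" using f by (auto simp: maxmaps_def F_def PiE_iff)
      then show ?thesis using False fb by blast
    qed
  next
    fix f assume "f \<in> G \<union> (\<Union>i\<in>Q - {b}. F i)"
    then consider "f \<in> G" | i where "i \<in> Q" "i \<noteq> b" "f \<in> F i" by blast
    then show "f \<in> maxmaps Q b z"
    proof cases
      case 1
      then have "f q \<in> (if q = b then {b} else if q = z then {z} else Q)" if "q \<in> Q" for q
        using that unfolding G_def by (rule PiE_mem)
      moreover have "f \<in> extensional Q" using 1 by (auto simp: G_def PiE_iff)
      ultimately show ?thesis using assms unfolding maxmaps_def PiE_iff
        by (smt (verit) mem_Collect_eq singletonD)
    next
      case 2
      then have m: "f q \<in> (if q = b then {i} else if q = z then {z} else {i, z})" if "q \<in> Q" for q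
        using that unfolding F_def by (blast intro: PiE_mem)
      have fb: "f b = i" "f z = z" using m[OF assms(2)] m[OF assms(3)] assms by auto
      have iz: "f q \<in> {i, z}" if "q \<in> Q" for q using m[OF that] by (auto split: if_splits)
      have "f \<in> extensional Q" using 2 by (simp add: F_def PiE_iff)
      moreover have "f q \<in> Q" if "q \<in> Q" for q
        using iz[OF that] 2 assms(3) by blast
      ultimately show ?thesis using fb iz unfolding maxmaps_def PiE_iff
        by blast
    qed
  qed
  have "card G = (\<Prod>q\<in>Q. if q = b then 1 else if q = z then 1 else ?n)"
    unfolding G_def card_PiE[OF assms(1)] by (rule prod.cong) auto
  also have "\<dots> = ?n ^ (?n - 2)"
    using prod_two_special[OF assms, of 1 1] by simp
  finally have cG: "card G = ?n ^ (?n - 2)" .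
  have cF: "card (F i) = (if i = z then 1 else 2 ^ (?n - 2))" for i
  proof -
    have "card (F i) = (\<Prod>q\<in>Q. if q = b then 1 else if q = z then 1 else card {i, z})"
      unfolding F_def card_PiE[OF assms(1)] by (rule prod.cong) auto
    also have "\<dots> = card {i, z} ^ (?n - 2)"
      using prod_two_special[OF assms, of 1 1] by simp
    finally show ?thesis by (auto simp: card_insert_if numeral_2_eq_2)
  qed
  have finF: "finite (F i)" for i
    unfolding F_def by (rule finite_PiE) (use assms in auto)
  have finG: "finite G"
    unfolding G_def by (rule finite_PiE) (use assms in auto)
  have Fb: "f b = i" if "f \<in> F i" for f i
    using PiE_mem[OF that[unfolded F_def] assms(2)] by simp
  have Gb: "f b = b" if "f \<in> G" for f
    using PiE_mem[OF that[unfolded G_def] assms(2)] by simp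
  have "card (\<Union>i\<in>Q - {b}. F i) = (\<Sum>i\<in>Q - {b}. card (F i))"
    by (rule card_UN_disjoint) (use assms finF Fb in \<open>blast+\<close>)
  also have "\<dots> = (\<Sum>i\<in>insert z (Q - {b, z}). card (F i))"
    by (rule sum.cong) (use assms in auto)
  also have "\<dots> = 1 + (\<Sum>i\<in>Q - {b, z}. card (F i))"
    using assms by (subst sum.insert) (auto simp: cF)
  also have "(\<Sum>i\<in>Q - {b, z}. card (F i)) = (\<Sum>i\<in>Q - {b, z}. 2 ^ (?n - 2))"
    by (rule sum.cong) (auto simp: cF)
  also have "\<dots> = (?n - 2) * 2 ^ (?n - 2)"
    using assms by (simp add: card_Diff_subset)
  finally have cU: "card (\<Union>i\<in>Q - {b}. F i) = 1 + (?n - 2) * 2 ^ (?n - 2)" .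
  have "card (maxmaps Q b z) = card G + card (\<Union>i\<in>Q - {b}. F i)"
    unfolding eq by (rule card_Un_disjoint) (use finG finF assms Fb Gb in \<open>blast+\<close>)
  then show ?thesis
    by (simp add: cG cU sigma_bound_def)
qed

text \<open>Removing a minimal element leaves the up-sets of the others unchanged, and its own
  up-set has at most \<open>card Q\<close> elements. A chain is therefore the worst case.\<close>

lemma sum_card_up_le:
  fixes Q :: "'b::order set" and G :: "nat \<Rightarrow> nat"
  assumes "finite Q" "mono G"
  shows "(\<Sum>i\<in>Q. G (card {q\<in>Q. i \<le> q})) \<le> (\<Sum>k=1..card Q. G k)"
  using assms(1)
proof (induction "card Q" arbitrary: Q)
  case 0
  then show ?case by simp
next
  case (Suc m)
  then have "Q \<noteq> {}" by auto
  then obtain a where a: "a \<in> Q" "\<And>q. q \<in> Q \<Longrightarrow> q \<le> a \<Longrightarrow> a = q"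
    using finite_has_minimal[OF Suc.prems] by metis
  have c: "card (Q - {a}) = m" using a Suc by simp
  have "(\<Sum>i\<in>Q. G (card {q\<in>Q. i \<le> q}))
      = G (card {q\<in>Q. a \<le> q}) + (\<Sum>i\<in>Q - {a}. G (card {q\<in>Q. i \<le> q}))"
    using a Suc.prems by (simp add: sum.remove)
  also have "(\<Sum>i\<in>Q - {a}. G (card {q\<in>Q. i \<le> q})) = (\<Sum>i\<in>Q - {a}. G (card {q\<in>Q - {a}. i \<le> q}))"
  proof (rule sum.cong)
    fix i assume "i \<in> Q - {a}"
    then have "{q\<in>Q. i \<le> q} = {q\<in>Q - {a}. i \<le> q}" using a by auto
    then show "G (card {q\<in>Q. i \<le> q}) = G (card {q\<in>Q - {a}. i \<le> q})" by simp
  qed simp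
  also have "\<dots> \<le> (\<Sum>k=1..m. G k)"
    using Suc.hyps(1)[of "Q - {a}"] c Suc.prems by simp
  also have "G (card {q\<in>Q. a \<le> q}) \<le> G (Suc m)"
    using Suc by (intro monoD[OF assms(2)]) (auto intro: card_mono)
  finally show ?case
    by (simp add: Suc.hyps(2)[symmetric])
qed

text \<open>The comparable pairs and their reversals together fit into \<open>U \<times> U\<close>
  and overlap only on the diagonal.\<close>

lemma card_comparable_pairs_le:
  fixes U :: "'b::order set"
  assumes "finite U"
  shows "2 * card {(x, y). x \<in> U \<and> y \<in> U \<and> x \<le> y} \<le> card U * (card U + 1)"
proof -
  let ?C = "{(x, y). x \<in> U \<and> y \<in> U \<and> x \<le> y}" and ?D = "{(x, y). x \<in> U \<and> y \<in> U \<and> y \<le> x}"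
  have fin: "finite (U \<times> U)" using assms by simp
  have fC: "finite ?C" "finite ?D" by (rule finite_subset[OF _ fin]; auto)+
  have "?D = prod.swap ` ?C" by auto
  then have "card ?D = card ?C" by (simp add: card_image)
  then have "2 * card ?C = card (?C \<union> ?D) + card (?C \<inter> ?D)"
    using card_Un_Int[OF fC] by simp
  also have "card (?C \<union> ?D) \<le> card (U \<times> U)" by (rule card_mono[OF fin]) auto
  also have "card (?C \<inter> ?D) \<le> card ((\<lambda>x. (x, x)) ` U)"
    by (rule card_mono) (use assms in auto)
  also have "\<dots> \<le> card U" by (rule card_image_le[OF assms])
  finally show ?thesis by (simp add: card_cartesian_product)
qed

text \<open>By \<open>1 + x \<le> exp x\<close>, passing from a positive \<open>K\<close> to
  \<open>K + 1 \<le> n\<close> multiplies the power by at least \<open>exp (p / n)\<close>. The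
  second hypothesis on \<open>c\<close> is what then closes the induction step.\<close>

lemma sum_powers_le:
  fixes c :: real
  assumes "1 \<le> c" "c \<le> (c - 1) * exp (real p / real n)" "K \<le> n"
  shows "(\<Sum>k=1..K. real k ^ p) \<le> c * real K ^ p"
  using assms(3)
proof (induction K)
  case 0
  then show ?case using assms(1) by simp
next
  case (Suc K)
  show ?case
  proof (cases "K = 0")
    case True
    then show ?thesis using assms(1) by simp
  next
    case False
    have "real K / real (Suc K) = 1 + - (1 / real (Suc K))"
      by (simp add: field_simps)
    also have "\<dots> \<le> exp (- (1 / real (Suc K)))"
      by (rule exp_ge_add_one_self)
    also have "\<dots> \<le> exp (- (1 / real n))"
      using Suc.prems by (simp add: frac_le)
    finally have "(real K / real (Suc K)) ^ p \<le> exp (- (1 / real n)) ^ p"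
      by (intro power_mono) auto
    also have "\<dots> = inverse (exp (real p / real n))"
      by (simp add: exp_of_nat_mult[symmetric] exp_minus[symmetric])
    finally have "real K ^ p * exp (real p / real n) \<le> real (Suc K) ^ p"
      by (simp add: power_divide field_simps del: of_nat_Suc)
    have "c * real K ^ p \<le> (c - 1) * exp (real p / real n) * real K ^ p"
      using assms(2) by (intro mult_right_mono) auto
    also have "\<dots> = (c - 1) * (real K ^ p * exp (real p / real n))" by simp
    also have "\<dots> \<le> (c - 1) * real (Suc K) ^ p"
      using assms(1) \<open>real K ^ p * exp (real p / real n) \<le> real (Suc K) ^ p\<close>
      by (intro mult_left_mono) auto
    finally show ?thesis
      using Suc by (simp add: algebra_simps)
  qed
qed

text \<open>The two power sums are at most \<open>9 / 5\<close> and \<open>2\<close> times their last terms, and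
  \<open>9 / 5 + 2 / n \<le> 2\<close>. The quadratic Taylor bounds for these ratios need \<open>n \<ge> 13\<close>; the full
  inequality is nearly sharp at \<open>n = 6\<close>, so small \<open>n\<close> are computed.\<close>

lemma sum_powers_le_large:
  assumes "n \<ge> 13"
  shows "(\<Sum>k=1..n. (k + 1) * k ^ (n - 3)) \<le> 2 * n ^ (n - 2)"
proof -
  define p where "p = n - 3"
  have n: "n = p + 3" "n - 2 = Suc p" and p: "p \<ge> 10" using assms by (auto simp: p_def)
  \<comment> \<open>\<open>11 / 26\<close> is half of \<open>11 / 13\<close>, the value of
    \<open>(n - 2) / n\<close> at \<open>n = 13\<close>. The goal \<open>9 / 4\<close> is
    \<open>c / (c - 1)\<close> for \<open>c = 9 / 5\<close>; the quadratic Taylor bound at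
    \<open>11 / 13\<close> falls short of it, so the exponent is halved and the bound
    squared.\<close>
  have "11 / 26 \<le> real (Suc p) / real n / 2" using p by (simp add: n field_simps)
  then have "exp (11 / 26) \<le> exp (real (Suc p) / real n / 2)" by simp
  moreover have "1 + 11 / 26 + (11 / 26)\<^sup>2 / 2 \<le> exp (11 / 26 :: real)"
    by (rule exp_lower_Taylor_quadratic) simp
  moreover have "(3 / 2 :: real) \<le> 1 + 11 / 26 + (11 / 26)\<^sup>2 / 2"
    by (simp add: power2_eq_square)
  ultimately have "3 / 2 \<le> exp (real (Suc p) / real n / 2)"
    by linarith
  then have "(3 / 2)\<^sup>2 \<le> exp (real (Suc p) / real n / 2) ^ 2"
    by (rule power_mono) simp
  also have "\<dots> = exp (real (Suc p) / real n)"
    by (simp only: exp_double[symmetric]) (simp del: of_nat_Suc)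
  finally have 1: "9 / 4 \<le> exp (real (Suc p) / real n)" by (simp add: power2_eq_square)
  \<comment> \<open>Likewise \<open>10 / 13\<close> is \<open>(n - 3) / n\<close> at
    \<open>n = 13\<close>, and the goal \<open>2\<close> is \<open>c / (c - 1)\<close> for
    \<open>c = 2\<close>.\<close>
  have "10 / 13 \<le> real p / real n" using p by (simp add: n field_simps)
  then have "exp (10 / 13) \<le> exp (real p / real n)" by simp
  moreover have "1 + 10 / 13 + (10 / 13)\<^sup>2 / 2 \<le> exp (10 / 13 :: real)"
    by (rule exp_lower_Taylor_quadratic) simp
  moreover have "(2 :: real) \<le> 1 + 10 / 13 + (10 / 13)\<^sup>2 / 2"
    by (simp add: power2_eq_square)
  ultimately have 2: "2 \<le> exp (real p / real n)"
    by linarith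
  have "real (\<Sum>k=1..n. (k + 1) * k ^ p) = (\<Sum>k=1..n. real k ^ Suc p) + (\<Sum>k=1..n. real k ^ p)"
    by (simp add: algebra_simps sum.distrib)
  also have "\<dots> \<le> 9 / 5 * real n ^ Suc p + 2 * real n ^ p"
    using sum_powers_le[of "9 / 5" "Suc p" n n] sum_powers_le[of 2 p n n] 1 2 by simp
  also have "\<dots> \<le> 9 / 5 * real n ^ Suc p + real n / 5 * real n ^ p"
    by (intro add_left_mono mult_right_mono) (use p n in auto)
  also have "\<dots> = real (2 * n ^ Suc p)" by simp
  finally show ?thesis
    unfolding n(2) p_def[symmetric] by (simp only: of_nat_le_iff)
qed

lemma sum_powers_less:
  assumes "n \<ge> 4"
  shows "(\<Sum>k=1..n. (k + 1) * k ^ (n - 3)) < 2 * sigma_bound n"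
proof (cases "n \<ge> 13")
  case True
  then show ?thesis using sum_powers_le_large[OF True] by (simp add: sigma_bound_def)
next
  case False
  then have "n \<in> {4, 5, 6, 7, 8, 9, 10, 11, 12}" using assms by auto
  then show ?thesis
    by (auto simp: sigma_bound_def sum.atLeast1_atMost_eq lessThan_nat_numeral lessThan_Suc
      numeral_2_eq_2[symmetric])
qed

section \<open>Monotone maps with and without comparable middle points\<close>

definition monomaps :: "'b::order set \<Rightarrow> 'b \<Rightarrow> ('b \<Rightarrow> 'b) set" where
  "monomaps Q z = {f \<in> Q \<rightarrow>\<^sub>E Q. f z = z \<and> (\<forall>p\<in>Q. \<forall>q\<in>Q. p \<le> q \<longrightarrow> f p \<le> f q)}"

lemma finite_monomaps: "finite Q \<Longrightarrow> finite (monomaps Q z)"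
  unfolding monomaps_def by (rule finite_subset[OF _ finite_PiE[of Q "\<lambda>_. Q"]]) auto

text \<open>All values of \<open>f\<close> lie above \<open>f b\<close>. If \<open>f b\<close> is
  not \<open>b\<close>, none of them is the bottom, and the antichain leaves only \<open>f b\<close>
  and \<open>z\<close>.\<close>

lemma monomaps_antichain:
  fixes Q :: "'b::order set"
  assumes "b \<in> Q" "\<And>q. q \<in> Q \<Longrightarrow> b \<le> q"
    and anti: "\<And>p q. p \<in> Q - {b, z} \<Longrightarrow> q \<in> Q - {b, z} \<Longrightarrow> p \<le> q \<Longrightarrow> p = q"
    and z: "\<And>q. q \<in> Q \<Longrightarrow> q \<le> z"
  shows "monomaps Q z \<subseteq> maxmaps Q b z"
proof
  fix f assume f: "f \<in> monomaps Q z"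
  have fQ: "f q \<in> Q" if "q \<in> Q" for q using f that by (auto simp: monomaps_def)
  have le: "f b \<le> f q" if "q \<in> Q" for q using f that assms(1,2) unfolding monomaps_def by blast
  have "f q \<in> {f b, z}" if fb: "f b \<noteq> b" and q: "q \<in> Q" for q
  proof (cases "f b = z \<or> f q = z")
    case True
    then show ?thesis using le[OF q] z[OF fQ[OF q]] by auto
  next
    case False
    moreover have "f q \<noteq> b" using fb le[OF q] assms(2)[OF fQ[OF assms(1)]] by auto
    ultimately show ?thesis using anti[of "f b" "f q"] le[OF q] fQ q assms(1) fb by auto
  qed
  then have "f b = b \<or> (\<forall>q\<in>Q. f q \<in> {f b, z})" by blast
  moreover have "f \<in> Q \<rightarrow>\<^sub>E Q" "f z = z" using f by (simp_all add: monomaps_def)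
  ultimately show "f \<in> maxmaps Q b z" by (simp add: maxmaps_def)
qed

text \<open>All values lie in the up-set \<open>U\<close> of \<open>i\<close>, and those at
  \<open>b\<close> and \<open>z\<close> are prescribed. So \<open>f\<close> is determined by the
  comparable pair \<open>(f x, f y)\<close> in \<open>U\<close> and by its values on the
  \<open>card Q - 4\<close> remaining points.\<close>

lemma card_monomaps_fiber_le:
  fixes Q :: "'b::order set"
  assumes fin: "finite Q" and b: "b \<in> Q" "\<And>q. q \<in> Q \<Longrightarrow> b \<le> q" and z: "z \<in> Q"
    and xy: "x \<in> Q - {b, z}" "y \<in> Q - {b, z}" "x < y" and bz: "b \<noteq> z"
  shows "2 * card {f \<in> monomaps Q z. f b = i}
    \<le> (card {q \<in> Q. i \<le> q} + 1) * card {q \<in> Q. i \<le> q} ^ (card Q - 3)"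
proof -
  define U where "U = {q \<in> Q. i \<le> q}"
  define R where "R = Q - {b, z, x, y}"
  have "card {b, z, x, y} = 4" using xy bz by auto
  moreover have "{b, z, x, y} \<subseteq> Q" using b z xy by auto
  ultimately have cR: "card R = card Q - 4" and n: "card Q \<ge> 4"
    unfolding R_def using fin card_mono[OF fin] by (simp_all add: card_Diff_subset, metis)
  have finU: "finite U" using fin by (simp add: U_def)
  let ?C = "{(u, v). u \<in> U \<and> v \<in> U \<and> u \<le> v}"
  let ?S = "{f \<in> monomaps Q z. f b = i}"
  let ?h = "\<lambda>f. ((f x, f y), restrict f R)"
  have inj: "inj_on ?h ?S"
  proof (rule inj_onI)
    fix f g assume f: "f \<in> ?S" and g: "g \<in> ?S" and eq: "?h f = ?h g"
    show "f = g"
    proof (rule extensionalityI)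
      show "f \<in> extensional Q" "g \<in> extensional Q"
        using f g by (auto simp: monomaps_def PiE_iff)
      fix q assume "q \<in> Q"
      then consider "q = b" | "q = z" | "q = x" | "q = y" | "q \<in> R" unfolding R_def by blast
      then show "f q = g q"
      proof cases
        case 5
        then show ?thesis using eq by (metis Pair_inject restrict_apply')
      qed (use f g eq in \<open>auto simp: monomaps_def\<close>)
    qed
  qed
  have sub: "?h ` ?S \<subseteq> ?C \<times> (R \<rightarrow>\<^sub>E U)"
  proof
    fix w assume "w \<in> ?h ` ?S"
    then obtain f where f: "f \<in> monomaps Q z" "f b = i" and w: "w = ?h f" by blast
    have "f q \<in> U" if "q \<in> Q" for q
      using f that b by (force simp: monomaps_def U_def)
    moreover have "f x \<le> f y" using f xy by (auto simp: monomaps_def)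
    moreover have "R \<subseteq> Q" by (auto simp: R_def)
    ultimately show "w \<in> ?C \<times> (R \<rightarrow>\<^sub>E U)"
      using xy w by auto
  qed
  have "finite ?C" by (rule finite_subset[of _ "U \<times> U"]) (use finU in auto)
  moreover have "finite (R \<rightarrow>\<^sub>E U)" by (rule finite_PiE) (use fin finU in \<open>auto simp: R_def\<close>)
  ultimately have "finite (?C \<times> (R \<rightarrow>\<^sub>E U))" by (rule finite_cartesian_product)
  with inj sub have "card ?S \<le> card (?C \<times> (R \<rightarrow>\<^sub>E U))" by (rule card_inj_on_le)
  also have "\<dots> = card ?C * card U ^ (card Q - 4)"
    using fin by (simp add: card_cartesian_product card_PiE R_def cR[unfolded R_def])
  finally have "2 * card ?S \<le> (2 * card ?C) * card U ^ (card Q - 4)" by simp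
  also have "\<dots> \<le> (card U * (card U + 1)) * card U ^ (card Q - 4)"
    by (rule mult_right_mono[OF card_comparable_pairs_le[OF finU]]) simp
  also have "\<dots> = (card U + 1) * card U ^ Suc (card Q - 4)"
    by (simp add: algebra_simps)
  also have "Suc (card Q - 4) = card Q - 3" using n by simp
  finally show ?thesis by (simp add: U_def)
qed

text \<open>Splitting by the value at \<open>b\<close> gives bounds that depend only on sizes of
  up-sets; the chain as worst case yields the sum in \<open>sum_powers_less\<close>. Doubling
  throughout avoids fractions.\<close>

lemma card_monomaps_less:
  fixes Q :: "'b::order set"
  assumes fin: "finite Q" and b: "b \<in> Q" "\<And>q. q \<in> Q \<Longrightarrow> b \<le> q" and z: "z \<in> Q" and bz: "b \<noteq> z"
    and xy: "x \<in> Q - {b, z}" "y \<in> Q - {b, z}" "x < y"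
  shows "card (monomaps Q z) < sigma_bound (card Q)"
proof -
  let ?G = "\<lambda>k. (k + 1) * k ^ (card Q - 3)"
  have "card {b, z, x, y} = 4" using xy bz by auto
  moreover have "{b, z, x, y} \<subseteq> Q" using b z xy by auto
  ultimately have n: "card Q \<ge> 4"
    using card_mono[OF fin] by metis
  have eq: "(\<Union>i\<in>Q. {f \<in> monomaps Q z. f b = i}) = monomaps Q z"
    using b by (auto simp: monomaps_def)
  have "card (monomaps Q z) \<le> (\<Sum>i\<in>Q. card {f \<in> monomaps Q z. f b = i})"
    using card_UN_le[OF fin, of "\<lambda>i. {f \<in> monomaps Q z. f b = i}"] unfolding eq .
  then have "2 * card (monomaps Q z) \<le> (\<Sum>i\<in>Q. 2 * card {f \<in> monomaps Q z. f b = i})"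
    by (simp add: sum_distrib_left[symmetric])
  also have "\<dots> \<le> (\<Sum>i\<in>Q. ?G (card {q \<in> Q. i \<le> q}))"
    by (rule sum_mono) (rule card_monomaps_fiber_le[OF fin b z xy bz])
  also have "\<dots> \<le> (\<Sum>k=1..card Q. ?G k)"
    by (rule sum_card_up_le[OF fin]) (auto intro!: monoI add_mono mult_mono power_mono)
  also have "\<dots> < 2 * sigma_bound (card Q)"
    by (rule sum_powers_less[OF n])
  finally show ?thesis by simp
qed

lemma card_monomaps_le_cases:
  fixes Q :: "'b::order set"
  assumes fin: "finite Q" and b: "b \<in> Q" "\<And>q. q \<in> Q \<Longrightarrow> b \<le> q"
    and z: "z \<in> Q" "\<And>q. q \<in> Q \<Longrightarrow> q \<le> z" and bz: "b \<noteq> z"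
  shows "monomaps Q z \<subseteq> maxmaps Q b z \<or> card (monomaps Q z) < sigma_bound (card Q)"
proof (cases "\<exists>x\<in>Q - {b, z}. \<exists>y\<in>Q - {b, z}. x < y")
  case True
  then show ?thesis using card_monomaps_less[OF fin b z(1) bz] by blast
next
  case False
  then have "p = q" if "p \<in> Q - {b, z}" "q \<in> Q - {b, z}" "p \<le> q" for p q
    using that by (auto simp: order_le_less)
  then show ?thesis using monomaps_antichain[OF b _ z(2)] by blast
qed

section \<open>Lower bound on the number of generators\<close>

locale maxmaps_generators =
  fixes A :: "'a set" and Q :: "'s set" and b z :: 's and run :: "'a list \<Rightarrow> 's \<Rightarrow> 's"
  assumes finA: "finite A" and finQ: "finite Q" and b: "b \<in> Q" and z: "z \<in> Q" and bz: "b \<noteq> z"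
    and run_Nil: "\<And>q. run [] q = q"
    and run_append: "\<And>u v q. run (u @ v) q = run v (run u q)"
    and generates: "(\<lambda>w. restrict (run w) Q) ` (lists A - {[]}) = maxmaps Q b z"
begin

lemma run_maxmaps:
  assumes "w \<in> lists A"
  shows "run w z = z" "q \<in> Q \<Longrightarrow> run w q \<in> Q"
    "run w b \<noteq> b \<Longrightarrow> q \<in> Q \<Longrightarrow> run w q \<in> {run w b, z}"
proof -
  have *: "restrict (run w) Q \<in> maxmaps Q b z" if "w \<noteq> []"
    using assms that generates by blast
  show "run w z = z"
    using * z by (cases "w = []") (auto simp: run_Nil maxmaps_def)
  show "run w q \<in> Q" if "q \<in> Q"
    using * that by (cases "w = []") (auto simp: run_Nil maxmaps_def restrict_PiE_iff)
  show "run w q \<in> {run w b, z}" if "run w b \<noteq> b" "q \<in> Q"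
    using * that b by (cases "w = []") (auto simp: run_Nil maxmaps_def)
qed

lemma ex_word:
  assumes "\<And>q. q \<in> Q \<Longrightarrow> g q \<in> Q" "g z = z" "g b = b \<or> (\<forall>q\<in>Q. g q \<in> {g b, z})"
  shows "\<exists>w\<in>lists A. w \<noteq> [] \<and> (\<forall>q\<in>Q. run w q = g q)"
proof -
  have "restrict g Q \<in> maxmaps Q b z"
    using assms b z by (auto simp: maxmaps_def)
  then obtain w where "w \<in> lists A" "w \<noteq> []" "restrict g Q = restrict (run w) Q"
    unfolding generates[symmetric] by blast
  then show ?thesis
    by (metis restrict_apply')
qed

definition units :: "'a set" where
  "units = {a \<in> A. inj_on (run [a]) Q}"

lemma run_Cons: "run (a # w) q = run w (run [a] q)"
  using run_append[of "[a]" w q] by simp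

lemma inj_imp_onto: "w \<in> lists A \<Longrightarrow> inj_on (run w) Q \<Longrightarrow> run w ` Q = Q"
  using endo_inj_surj[OF finQ] run_maxmaps(2) by blast

text \<open>On a finite set an injective first factor is onto, so injectivity of a composite passes
  to the second factor.\<close>

lemma inj_iff_units: "w \<in> lists A \<Longrightarrow> inj_on (run w) Q \<longleftrightarrow> set w \<subseteq> units"
proof (induction w)
  case Nil
  then show ?case by (simp add: run_Nil inj_on_def)
next
  case (Cons a w)
  then have w: "w \<in> lists A" and a: "[a] \<in> lists A" by auto
  have eq: "run (a # w) = run w \<circ> run [a]" by (simp add: fun_eq_iff run_Cons[of a w])
  have "inj_on (run (a # w)) Q \<longleftrightarrow> inj_on (run [a]) Q \<and> inj_on (run w) Q"
    unfolding eq using inj_imp_onto[OF a] comp_inj_on_iff[of "run [a]" Q "run w"] inj_on_imageI2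
    by metis
  with Cons w a show ?case by (auto simp: units_def)
qed

text \<open>Moving \<open>b\<close> confines all values to \<open>run w b\<close> and
  \<open>z\<close>, so \<open>b\<close> is missed, whereas an injective self-map of a finite set is
  onto.\<close>

lemma moves_bottom_not_unit:
  assumes "w \<in> lists A" "run w b \<noteq> b"
  shows "\<not> inj_on (run w) Q"
proof
  assume "inj_on (run w) Q"
  then obtain q where "q \<in> Q" "run w q = b"
    using inj_imp_onto[OF assms(1)] b by (metis imageE)
  with run_maxmaps(3)[OF assms(1,2), of q] assms(2) bz show False by auto
qed

text \<open>Only nonempty words generate, so even the identity needs a word with at least one
  letter, and all its letters are units.\<close>

lemma ex_unit: "\<exists>a. a \<in> units"
proof -
  obtain w where w: "w \<in> lists A" "w \<noteq> []" "\<forall>q\<in>Q. run w q = q"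
    using ex_word[of "\<lambda>q. q"] by blast
  then have "inj_on (run w) Q" by (simp add: inj_on_def)
  with w show ?thesis using inj_iff_units by (metis hd_in_set subsetD)
qed

text \<open>With a single unit letter all permutations would be powers of it and hence commute.\<close>

lemma ex_two_units:
  assumes "card Q \<ge> 5"
  shows "\<exists>a a'. a \<in> units \<and> a' \<in> units \<and> a \<noteq> a'"
proof (rule ccontr)
  assume no: "\<not> ?thesis"
  obtain c where c: "c \<in> units" using ex_unit by blast
  have "card (Q - {b, z}) \<ge> 3"
    using assms finQ b z bz by (simp add: card_Diff_subset)
  then obtain S where "S \<subseteq> Q - {b, z}" "card S = 3" by (metis obtain_subset_with_card_n)
  then obtain x y t where xyt: "x \<in> Q - {b, z}" "y \<in> Q - {b, z}" "t \<in> Q - {b, z}"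
    "x \<noteq> y" "x \<noteq> t" "y \<noteq> t"
    by (auto simp: card_3_iff)
  let ?f = "\<lambda>q. if q = x then y else if q = y then x else q"
  let ?g = "\<lambda>q. if q = y then t else if q = t then y else q"
  obtain u where u: "u \<in> lists A" "\<forall>q\<in>Q. run u q = ?f q"
  proof -
    have "\<exists>w\<in>lists A. w \<noteq> [] \<and> (\<forall>q\<in>Q. run w q = ?f q)"
      by (rule ex_word) (use xyt in auto)
    then show ?thesis using that by blast
  qed
  obtain v where v: "v \<in> lists A" "\<forall>q\<in>Q. run v q = ?g q"
  proof -
    have "\<exists>w\<in>lists A. w \<noteq> [] \<and> (\<forall>q\<in>Q. run w q = ?g q)"
      by (rule ex_word) (use xyt in auto)
    then show ?thesis using that by blast
  qed
  have "inj_on (run u) Q" using u xyt by (auto simp: inj_on_def split: if_splits)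
  then have "\<forall>a\<in>set u. a = c" using inj_iff_units[OF u(1)] no c by blast
  moreover have "inj_on (run v) Q" using v xyt by (auto simp: inj_on_def split: if_splits)
  then have "\<forall>a\<in>set v. a = c" using inj_iff_units[OF v(1)] no c by blast
  ultimately have "u = replicate (length u) c" "v = replicate (length v) c"
    by (metis replicate_length_same)+
  then have "u @ v = v @ u"
    by (metis add.commute replicate_add)
  then have "run v (run u x) = run u (run v x)"
    by (metis run_append)
  then show False using u v xyt by auto
qed

lemma ex_moves_bottom: "\<exists>a\<in>A. run [a] b \<noteq> b"
proof (rule ccontr)
  assume no: "\<not> ?thesis"
  have fixb: "run w b = b" if "w \<in> lists A" for w
    using that
  proof (induction w)
    case Nil
    then show ?case by (simp add: run_Nil)
  next
    case (Cons a w)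
    then show ?case using no by (auto simp: run_Cons[of a w])
  qed
  obtain w where "w \<in> lists A" "\<forall>q\<in>Q. run w q = z"
    using ex_word[of "\<lambda>_. z"] z by blast
  then show False using fixb b bz by metis
qed

text \<open>A letter sending some \<open>q \<noteq> b\<close> to \<open>b\<close> must fix
  \<open>b\<close>, since otherwise \<open>b\<close> is not a value; hence it merges two states.
  Without such letters no word takes another state to \<open>b\<close>, though some map in
  \<open>maxmaps\<close> does. This supplies the third letter for three states.\<close>

lemma ex_fixes_bottom_not_unit:
  assumes "card Q \<ge> 3"
  shows "\<exists>a\<in>A. run [a] b = b \<and> a \<notin> units"
proof (rule ccontr)
  assume no: "\<not> ?thesis"
  have step: "run [a] q \<noteq> b" if a: "a \<in> A" and q: "q \<in> Q" "q \<noteq> b" for a q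
  proof
    assume e: "run [a] q = b"
    have l: "[a] \<in> lists A" using a by simp
    have ab: "run [a] b = b"
      using run_maxmaps(3)[OF l _ q(1)] e bz by auto
    then have "\<not> inj_on (run [a]) Q" using e q b by (metis inj_onD)
    with ab show False using no a by (auto simp: units_def)
  qed
  have keep: "run w q \<noteq> b" if "w \<in> lists A" "q \<in> Q" "q \<noteq> b" for w q
    using that
  proof (induction w arbitrary: q)
    case Nil
    then show ?case by (simp add: run_Nil)
  next
    case (Cons a w)
    then have "run [a] q \<in> Q" "run [a] q \<noteq> b" using step run_maxmaps(2)[of "[a]"] by auto
    then show ?case using Cons by (auto simp: run_Cons[of a w])
  qed
  have "card (Q - {b, z}) \<noteq> 0"
    using assms finQ b z bz by (simp add: card_Diff_subset)
  then obtain x where x: "x \<in> Q" "x \<noteq> b" "x \<noteq> z"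
    by (metis card.empty DiffD1 DiffD2 all_not_in_conv insertCI)
  have "\<exists>w\<in>lists A. w \<noteq> [] \<and> (\<forall>q\<in>Q. run w q = (if q = x then b else q))"
    by (rule ex_word) (use b x in auto)
  then obtain w where "w \<in> lists A" "\<forall>q\<in>Q. run w q = (if q = x then b else q)"
    by blast
  then show False using keep[of _ x] x by metis
qed

section \<open>Letters merging exactly one pair of states\<close>

definition collapses :: "'a \<Rightarrow> 's \<Rightarrow> 's \<Rightarrow> bool" where
  "collapses a x y \<longleftrightarrow>
     (\<forall>p\<in>Q. \<forall>q\<in>Q. p \<noteq> q \<longrightarrow> (run [a] p = run [a] q \<longleftrightarrow> {p, q} = {x, y}))"

text \<open>In a word whose action merges exactly one pair, the first non-unit letter already merges
  (the image of) this pair and no other.\<close>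

lemma ex_collapses:
  assumes x: "x \<in> Q - {b, z}" and y: "y \<in> Q" "x \<noteq> y"
  shows "\<exists>a\<in>A. \<exists>x'\<in>Q - {b, z}. \<exists>y'\<in>Q. x' \<noteq> y' \<and> collapses a x' y' \<and>
    (y' = b \<longleftrightarrow> y = b) \<and> (y' = z \<longleftrightarrow> y = z)"
proof -
  let ?g = "\<lambda>q. if q = x then y else q"
  obtain w where w: "w \<in> lists A" "\<forall>q\<in>Q. run w q = ?g q"
  proof -
    have "\<exists>w\<in>lists A. w \<noteq> [] \<and> (\<forall>q\<in>Q. run w q = ?g q)"
      by (rule ex_word) (use x y in auto)
    then show ?thesis using that by blast
  qed
  have "run w x = run w y" using w x y by auto
  then have "\<not> inj_on (run w) Q" using x y by (metis DiffD1 inj_onD)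
  then have "\<exists>a\<in>set w. a \<notin> units" using inj_iff_units[OF w(1)] by blast
  then obtain u a v where uav: "w = u @ a # v" "a \<notin> units" "\<forall>c\<in>set u. \<not> c \<notin> units"
    using split_list_first_prop[of w "\<lambda>a. a \<notin> units"] by blast
  have l: "u \<in> lists A" "[a] \<in> lists A" "a \<in> A" using w uav by auto
  have run_w: "run w q = run v (run [a] (run u q))" for q
    unfolding uav by (simp add: run_append run_Cons[of a v])
  have inj: "inj_on (run u) Q" using inj_iff_units[OF l(1)] uav by blast
  have onto: "run u ` Q = Q" by (rule inj_imp_onto[OF l(1) inj])
  have ub: "run u b = b" using moves_bottom_not_unit[OF l(1)] inj by blast
  have uz: "run u z = z" by (rule run_maxmaps(1)[OF l(1)])
  have pair: "{p, q} = {run u x, run u y}"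
    if pq: "p \<in> Q" "q \<in> Q" "p \<noteq> q" and e: "run [a] p = run [a] q" for p q
  proof -
    obtain p' q' where p': "p' \<in> Q" "q' \<in> Q" "p = run u p'" "q = run u q'"
      using pq onto by (metis imageE)
    then have "?g p' = ?g q'" using e run_w w(2) by metis
    moreover have "p' \<noteq> q'" using p' pq by auto
    ultimately have "{p', q'} = {x, y}" by (auto split: if_splits)
    then show ?thesis using p' by (auto simp: doubleton_eq_iff)
  qed
  have "\<exists>p\<in>Q. \<exists>q\<in>Q. p \<noteq> q \<and> run [a] p = run [a] q"
    using uav(2) l by (auto simp: units_def inj_on_def)
  then obtain p q where "p \<in> Q" "q \<in> Q" "p \<noteq> q" "run [a] p = run [a] q" by blast
  then have axy: "run [a] (run u x) = run [a] (run u y)"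
    using pair[of p q] by (auto simp: doubleton_eq_iff)
  have "collapses a (run u x) (run u y)"
    unfolding collapses_def using pair axy by (auto simp: doubleton_eq_iff)
  moreover have "run u x \<in> Q - {b, z}"
    using x ub uz inj b z run_maxmaps(2)[OF l(1)] by (metis DiffD1 DiffD2 DiffI insert_iff inj_onD empty_iff)
  moreover have "run u y \<in> Q" "run u x \<noteq> run u y"
    using x y inj run_maxmaps(2)[OF l(1)] by (auto dest: inj_onD)
  \<comment> \<open>The prefix \<open>u\<close> acts as a permutation fixing \<open>b\<close> and
    \<open>z\<close>, so the kind of pair is preserved.\<close>
  moreover have "run u y = b \<longleftrightarrow> y = b" "run u y = z \<longleftrightarrow> y = z"
    using y ub uz inj b z by (metis inj_onD)+
  ultimately show ?thesis using l(3) by blast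
qed

lemma collapses_unique:
  assumes "collapses a x y" "collapses a x' y'" "x \<in> Q" "y \<in> Q" "x \<noteq> y"
  shows "{x, y} = {x', y'}"
  using assms unfolding collapses_def by blast

lemma collapses_not_unit: "collapses a x y \<Longrightarrow> x \<in> Q \<Longrightarrow> y \<in> Q \<Longrightarrow> x \<noteq> y \<Longrightarrow> a \<notin> units"
  unfolding collapses_def units_def by (auto simp: inj_on_def)

text \<open>A letter moving \<open>b\<close> has at most two values, but merging a single pair among
  at least four states leaves at least three.\<close>

lemma collapses_fixes_bottom:
  assumes "card Q \<ge> 4" "a \<in> A" "collapses a x y"
  shows "run [a] b = b"
proof (rule ccontr)
  assume nb: "run [a] b \<noteq> b"
  have l: "[a] \<in> lists A" using assms by simp
  have "inj_on (run [a]) (Q - {x})"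
    using assms(3) unfolding collapses_def inj_on_def by blast
  then have "card (run [a] ` (Q - {x})) = card (Q - {x})" by (rule card_image)
  moreover have "card (Q - {x}) \<ge> 3"
    using assms(1) finQ by (cases "x \<in> Q") auto
  moreover have "run [a] ` (Q - {x}) \<subseteq> {run [a] b, z}"
    using run_maxmaps(3)[OF l nb] by blast
  then have "card (run [a] ` (Q - {x})) \<le> card {run [a] b, z}"
    by (rule card_mono[rotated]) simp
  moreover have "card {run [a] b, z} \<le> 2"
    by (simp add: card_insert_if)
  ultimately show False by linarith
qed

text \<open>The letters exhibited are distinct: units are injective and the others are not. For four
  or more states the collapsing letters fix \<open>b\<close>, unlike \<open>m\<close>, and each
  determines the pair it merges, so the three kinds differ.\<close>

lemma card_alphabet_ge: "min_alpha (card Q) \<le> card A"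
proof -
  obtain u where u: "u \<in> units" using ex_unit by blast
  obtain m where m: "m \<in> A" "run [m] b \<noteq> b" using ex_moves_bottom by blast
  have mu: "m \<notin> units" using moves_bottom_not_unit[of "[m]"] m by (auto simp: units_def)
  have uA: "c \<in> A" if "c \<in> units" for c using that by (simp add: units_def)
  have le: "card S \<le> card A" if "S \<subseteq> A" for S using card_mono[OF finA that] .
  have two: "card Q \<ge> 2"
    using card_mono[OF finQ, of "{b, z}"] b z bz by simp
  consider "card Q = 2" | "card Q = 3" | "card Q \<ge> 4" using two by linarith
  then show ?thesis
  proof cases
    case 1
    then show ?thesis
      using le[of "{u, m}"] u mu m uA by (auto simp: min_alpha_def card_insert_if split: if_splits)
  next
    case 2
    then obtain f where f: "f \<in> A" "run [f] b = b" "f \<notin> units"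
      using ex_fixes_bottom_not_unit by auto
    have "card {u, m, f} = 3" using u m mu f by (auto simp: card_insert_if)
    then show ?thesis
      using le[of "{u, m, f}"] u m uA f 2 by (auto simp: min_alpha_def)
  next
    case 3
    then have "card (Q - {b, z}) \<ge> 2"
      using finQ b z bz by (simp add: card_Diff_subset)
    then obtain S where "S \<subseteq> Q - {b, z}" "card S = 2" by (metis obtain_subset_with_card_n)
    then obtain x y where xy: "x \<in> Q - {b, z}" "y \<in> Q - {b, z}" "x \<noteq> y"
      by (auto simp: card_2_iff)
    have xb: "x \<noteq> b" and xz: "x \<noteq> z" and yQ: "y \<in> Q" using xy by auto
    obtain a1 x1 where 1: "a1 \<in> A" "x1 \<in> Q - {b, z}" "collapses a1 x1 b"
      using ex_collapses[OF xy(1) b xb] by auto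
    obtain a2 x2 where 2: "a2 \<in> A" "x2 \<in> Q - {b, z}" "collapses a2 x2 z"
      using ex_collapses[OF xy(1) z xz] by auto
    obtain a3 x3 y3 where a3: "a3 \<in> A" "x3 \<in> Q - {b, z}" "y3 \<in> Q - {b, z}" "x3 \<noteq> y3"
      "collapses a3 x3 y3"
      using ex_collapses[OF xy(1) yQ xy(3)] xy by auto
    have d12: "a1 \<noteq> a2"
      using collapses_unique[of a1 x1 b x2 z] 1 2 b bz by (auto simp: doubleton_eq_iff)
    have d13: "a1 \<noteq> a3"
      using collapses_unique[of a1 x1 b x3 y3] 1 a3 b by (auto simp: doubleton_eq_iff)
    have d23: "a2 \<noteq> a3"
      using collapses_unique[of a2 x2 z x3 y3] 2 a3 z by (auto simp: doubleton_eq_iff)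
    have dm: "m \<notin> {a1, a2, a3}"
      using collapses_fixes_bottom[OF 3] 1 2 a3 m by blast
    have nu: "a1 \<notin> units" "a2 \<notin> units" "a3 \<notin> units"
      using collapses_not_unit[of a1 x1 b] collapses_not_unit[of a2 x2 z]
        collapses_not_unit[of a3 x3 y3] 1 2 a3 b z by auto
    have c5: "card {u, m, a1, a2, a3} = 5"
      using u mu nu dm d12 d13 d23 by (auto simp: card_insert_if)
    show ?thesis
    proof (cases "card Q = 4")
      case True
      then show ?thesis using le[of "{u, m, a1, a2, a3}"] c5 u uA m 1 2 a3
        by (auto simp: min_alpha_def)
    next
      case False
      then have "card Q \<ge> 5" using 3 by simp
      then obtain v v' where v: "v \<in> units" "v' \<in> units" "v \<noteq> v'" using ex_two_units by blast
      have "card {v, v', m, a1, a2, a3} = 6"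
        using v mu nu dm d12 d13 d23 by (auto simp: card_insert_if)
      then show ?thesis using le[of "{v, v', m, a1, a2, a3}"] v uA m 1 2 a3 3 False
        by (auto simp: min_alpha_def)
    qed
  qed
qed

end

section \<open>Generating all maximal maps\<close>

abbreviation swp :: "nat \<Rightarrow> nat \<Rightarrow> nat \<Rightarrow> nat" where
  "swp \<equiv> Transposition.transpose"

lemma conjugate_transpose:
  assumes "inj f"
  shows "f \<circ> Transposition.transpose x y = Transposition.transpose (f x) (f y) \<circ> f"
  using assms by (auto simp: fun_eq_iff Transposition.transpose_def inj_eq)

lemma conjugate_fun_upd_id:
  "Transposition.transpose x y \<circ> id(p := v) \<circ> Transposition.transpose x y =
    id(Transposition.transpose x y p := Transposition.transpose x y v)"
  by (auto simp: fun_eq_iff Transposition.transpose_def)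

text \<open>The case \<open>m = 0\<close> is split off so that \<open>cyc 0\<close> is the identity
  and \<open>cyc m\<close> permutes \<open>{1..m}\<close> for every \<open>m\<close>.\<close>

definition cyc :: "nat \<Rightarrow> nat \<Rightarrow> nat" where
  "cyc m q = (if 1 \<le> q \<and> q < m then q + 1 else if q = m then (if m = 0 then 0 else 1) else q)"

lemma cyc_permutes: "cyc m permutes {1..m}"
proof (rule inj_imp_permutes)
  show "inj_on (cyc m) {1..m}" by (auto simp: cyc_def inj_on_def split: if_splits)
qed (auto simp: cyc_def)

text \<open>From here on \<open>0\<close> is the bottom, \<open>{1..m}\<close> are the middle states
  and \<open>m + 1\<close> is the top. This is the generator that moves the bottom.\<close>

definition raise :: "nat \<Rightarrow> nat \<Rightarrow> nat" where
  "raise m q = (if q = 0 then 1 else if q \<le> m then m + 1 else q)"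

text \<open>\<open>H\<close> will consist of the actions of nonempty words, so it is not assumed to
  contain \<open>id\<close>.\<close>

locale comp_closed =
  fixes H :: "(nat \<Rightarrow> nat) set" and m :: nat
  assumes comp: "\<And>f g. f \<in> H \<Longrightarrow> g \<in> H \<Longrightarrow> f \<circ> g \<in> H"
begin

lemma power_in: "f \<in> H \<Longrightarrow> f ^^ Suc k \<in> H"
  by (induction k) (simp_all add: comp)

text \<open>If \<open>p ^^ k = id\<close> with \<open>k > 1\<close>, the inverse is
  \<open>p ^^ (k - 1)\<close>; the exponent must be positive because \<open>H\<close> may lack
  \<open>id\<close>.\<close>

lemma right_inverse_in:
  assumes "p \<in> H" "p permutes S" "finite S"
  shows "\<exists>p'\<in>H. p \<circ> p' = id"
proof -
  obtain k where k: "p ^^ k = id" "k > 1"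
    using permutation_is_nilpotent'[of p 1] assms permutation_permutes by blast
  then obtain j where "k = Suc (Suc j)" by (cases k rule: nat.exhaust; cases "k - 1") auto
  then show ?thesis using k power_in[OF assms(1), of j] by (intro bexI[of _ "p ^^ Suc j"]) simp_all
qed

text \<open>Conjugating \<open>swp 1 2\<close> by the cycle gives the adjacent transpositions;
  conjugating \<open>swp i j\<close> by \<open>swp j (j + 1)\<close> then widens it by one.\<close>

lemma transposes_in:
  assumes c: "cyc m \<in> H" and s: "swp 1 2 \<in> H" and m: "m \<ge> 2"
    and xy: "x \<in> {1..m}" "y \<in> {1..m}"
  shows "swp x y \<in> H"
proof -
  obtain c' where c': "c' \<in> H" "cyc m \<circ> c' = id"
    using right_inverse_in[OF c cyc_permutes] by auto
  have adj: "swp i (i + 1) \<in> H" if "1 \<le> i" "i < m" for i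
    using that
  proof (induction i rule: nat_induct_at_least)
    case base
    then show ?case using s by (simp add: numeral_2_eq_2)
  next
    case (Suc i)
    have "cyc m \<circ> swp i (i + 1) = swp (cyc m i) (cyc m (i + 1)) \<circ> cyc m"
      by (rule conjugate_transpose) (rule permutes_inj[OF cyc_permutes])
    moreover have "cyc m i = Suc i" "cyc m (i + 1) = Suc i + 1"
      using Suc by (auto simp: cyc_def)
    ultimately have "cyc m \<circ> swp i (i + 1) \<circ> c' = swp (Suc i) (Suc i + 1) \<circ> (cyc m \<circ> c')"
      by (simp only: comp_assoc)
    then have "swp (Suc i) (Suc i + 1) = cyc m \<circ> swp i (i + 1) \<circ> c'"
      using c' by simp
    moreover have "swp i (i + 1) \<in> H" using Suc by simp
    ultimately show ?case using comp[OF comp[OF c] c'(1)] by metis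
  qed
  have inc: "swp i (i + Suc k) \<in> H" if "1 \<le> i" "i + Suc k \<le> m" for i k
    using that
  proof (induction k)
    case 0
    then show ?case using adj[of i] by simp
  next
    case (Suc k)
    let ?t = "swp (i + Suc k) (i + Suc k + 1)"
    have "?t \<circ> swp i (i + Suc k) = swp i (i + Suc (Suc k)) \<circ> ?t"
      using conjugate_transpose[of ?t i "i + Suc k"] by simp
    then have "?t \<circ> swp i (i + Suc k) \<circ> ?t = swp i (i + Suc (Suc k))"
      by (simp add: comp_assoc)
    moreover have "?t \<in> H" using adj[of "i + Suc k"] Suc by simp
    moreover have "swp i (i + Suc k) \<in> H" using Suc by simp
    ultimately show ?case using comp by metis
  qed
  have less: "swp x y \<in> H" if "1 \<le> x" "x < y" "y \<le> m" for x y
    using inc[of x "y - x - 1"] that by simp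
  consider "x < y" | "y < x" | "x = y" by linarith
  then show ?thesis
  proof cases
    case 1
    then show ?thesis using less xy by simp
  next
    case 2
    then show ?thesis using less[of y x] xy by (simp add: transpose_commute)
  next
    case 3
    \<comment> \<open>The case \<open>x = y\<close> asks for the identity, obtained as a
      square.\<close>
    have "swp 1 2 \<circ> swp 1 2 \<in> H" using s comp by blast
    then show ?thesis using 3 by simp
  qed
qed

text \<open>Conjugation by \<open>swp 1 y\<close> moves the collapsed point from \<open>1\<close> to
  \<open>y\<close> and keeps the targets \<open>0\<close> and \<open>m + 1\<close>; a middle target
  needs a second conjugation.\<close>

lemma collapses_in:
  assumes tr: "\<And>x y. x \<in> {1..m} \<Longrightarrow> y \<in> {1..m} \<Longrightarrow> swp x y \<in> H"
    and e0: "id(1 := 0) \<in> H" and ez: "id(1 := m + 1) \<in> H"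
    and e2: "m \<ge> 2 \<Longrightarrow> id(1 := 2) \<in> H"
    and y: "y \<in> {1..m}" and v: "v \<le> m + 1" "v \<noteq> y"
  shows "id(y := v) \<in> H"
proof -
  have y1: "swp 1 y \<in> H" using tr y by auto
  have conj: "swp 1 y \<circ> id(1 := w) \<circ> swp 1 y \<in> H" if "id(1 := w) \<in> H" for w
    using y1 that comp by blast
  consider "v = 0" | "v = m + 1" | "v \<in> {1..m}" using v by fastforce
  then show ?thesis
  proof cases
    case 1
    then show ?thesis using conj[OF e0] y by (simp add: conjugate_fun_upd_id)
  next
    case 2
    then show ?thesis using conj[OF ez] y by (simp add: conjugate_fun_upd_id)
  next
    case 3
    then have m: "m \<ge> 2" using y v by auto
    \<comment> \<open>The target \<open>2\<close> becomes \<open>1\<close> if \<open>y = 2\<close>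
      and stays \<open>2\<close> otherwise. Conjugating by \<open>swp v' v\<close> corrects it and
      leaves \<open>y\<close> alone, as both points differ from \<open>y\<close>.\<close>
    define v' where "v' = swp 1 y 2"
    have 1: "id(y := v') \<in> H"
      using conj[OF e2[OF m]] by (simp add: conjugate_fun_upd_id v'_def)
    have v': "v' \<in> {1..m}" "v' \<noteq> y"
      using y m by (auto simp: v'_def Transposition.transpose_def)
    have "swp v' v \<circ> id(y := v') \<circ> swp v' v \<in> H"
      using tr[OF v'(1) 3] 1 comp by blast
    then show ?thesis using v v' by (simp add: conjugate_fun_upd_id)
  qed
qed

text \<open>Induction on the number of missed middle states: if \<open>f\<close> misses \<open>y\<close> and takes a value twice,
  once at \<open>p\<close>, then redirecting \<open>p\<close> to \<open>y\<close> enlarges the image, and \<open>f\<close> is recovered by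
  collapsing \<open>y\<close> afterwards.\<close>

lemma bottom_fixing_in:
  assumes id: "id \<in> H" and tr: "\<And>x y. x \<in> {1..m} \<Longrightarrow> y \<in> {1..m} \<Longrightarrow> swp x y \<in> H"
    and col: "\<And>y v. y \<in> {1..m} \<Longrightarrow> v \<le> m + 1 \<Longrightarrow> v \<noteq> y \<Longrightarrow> id(y := v) \<in> H"
    and f: "\<And>q. q \<notin> {1..m} \<Longrightarrow> f q = q" "\<And>q. q \<in> {1..m} \<Longrightarrow> f q \<le> m + 1"
  shows "f \<in> H"
  using f
proof (induction "card ({1..m} - f ` {1..m})" arbitrary: f rule: less_induct)
  case less
  let ?M = "{1..m}"
  show ?case
  proof (cases "?M \<subseteq> f ` ?M")
    case True
    then have "card ?M \<le> card (f ` ?M)" by (intro card_mono) auto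
    then have c: "card (f ` ?M) = card ?M" by (intro antisym card_image_le) auto
    then have im: "f ` ?M = ?M" using True by (metis card_subset_eq finite_imageI finite_atLeastAtMost)
    have "inj_on f ?M" using c by (intro eq_card_imp_inj_on) auto
    then have "bij_betw f ?M ?M" using im by (simp add: bij_betw_def)
    then have "f permutes ?M" using less.prems(1) by (intro bij_imp_permutes)
    then show ?thesis
      using finite_atLeastAtMost
    proof (induction rule: permutes_induct)
      case id
      then show ?case by (rule assms(1))
    next
      case (swap a b p)
      then show ?case by (intro comp tr)
    qed
  next
    case False
    then obtain y where y: "y \<in> ?M" "y \<notin> f ` ?M" by blast
    \<comment> \<open>A point sent to \<open>0\<close> or \<open>m + 1\<close> serves as well as one
      with a repeated value, since only middle values count.\<close>
    have "\<exists>p\<in>?M. f ` (?M - {p}) \<inter> ?M = f ` ?M \<inter> ?M"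
    proof (cases "f ` ?M \<subseteq> ?M")
      case True
      have "\<not> inj_on f ?M" using endo_inj_surj[OF _ True] False by auto
      then obtain p q where pq: "p \<in> ?M" "q \<in> ?M" "p \<noteq> q" "f p = f q" by (auto simp: inj_on_def)
      then have "f ` (?M - {p}) = f ` ?M" by (auto simp: image_iff) (metis DiffI singletonD atLeastAtMost_iff One_nat_def)
      then show ?thesis using pq by blast
    next
      case False
      then obtain p where "p \<in> ?M" "f p \<notin> ?M" by blast
      then show ?thesis by (intro bexI[of _ p]) auto
    qed
    then obtain p where p: "p \<in> ?M" "f ` (?M - {p}) \<inter> ?M = f ` ?M \<inter> ?M" by blast
    let ?g = "f(p := y)"
    have "?g ` ?M \<inter> ?M = insert y (f ` ?M \<inter> ?M)"
      using p y by (auto simp: image_iff)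
    then have "?M - ?g ` ?M \<subset> ?M - f ` ?M" using y by blast
    then have "card (?M - ?g ` ?M) < card (?M - f ` ?M)" by (intro psubset_card_mono) auto
    then have g: "?g \<in> H" by (rule less.hyps) (use less.prems p y in auto)
    have "id(y := f p) \<in> H" using less.prems p y by (intro col) auto
    then have "id(y := f p) \<circ> ?g \<in> H" using g comp by blast
    moreover have "id(y := f p) \<circ> ?g = f"
    proof
      fix q
      \<comment> \<open>As \<open>y\<close> is not a value of \<open>f\<close>, the final collapse
        affects only the redirected point \<open>p\<close>.\<close>
      have "f q \<noteq> y" using y less.prems(1)[of q] by (cases "q \<in> ?M") auto
      then show "(id(y := f p) \<circ> ?g) q = f q" by simp
    qed
    ultimately show ?thesis by simp
  qed
qed

lemma maxmaps_in:
  assumes id: "id \<in> H" and tr: "\<And>x y. x \<in> {1..m} \<Longrightarrow> y \<in> {1..m} \<Longrightarrow> swp x y \<in> H"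
    and col: "\<And>y v. y \<in> {1..m} \<Longrightarrow> v \<le> m + 1 \<Longrightarrow> v \<noteq> y \<Longrightarrow> id(y := v) \<in> H"
    and raise: "raise m \<in> H"
    and f: "f \<in> maxmaps {..m + 1} 0 (m + 1)"
  shows "\<exists>h\<in>H. \<forall>q\<in>{..m + 1}. h q = f q"
proof -
  note inH = bottom_fixing_in[OF id tr col]
  have fQ: "f q \<le> m + 1" if "q \<le> m + 1" for q
    using f that by (auto simp: maxmaps_def)
  have fz: "f (m + 1) = m + 1" using f by (simp add: maxmaps_def)
  show ?thesis
  proof (cases "f 0 = 0")
    case True
    let ?h = "\<lambda>q. if q \<in> {1..m} then f q else q"
    have "?h \<in> H" by (rule inH) (use fQ in auto)
    moreover have "?h q = f q" if q: "q \<le> m + 1" for q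
    proof -
      consider "q = 0" | "q = m + 1" | "q \<in> {1..m}" using q by fastforce
      then show ?thesis using True fz by cases auto
    qed
    ultimately show ?thesis by (intro bexI[of _ ?h]) simp_all
  next
    case False
    then have two: "f q = f 0 \<or> f q = m + 1" if "q \<le> m + 1" for q
      using f that by (auto simp: maxmaps_def)
    show ?thesis
    proof (cases "f 0 = m + 1")
      case True
      have "(raise m \<circ> raise m) q = f q" if "q \<le> m + 1" for q
        using two[OF that] True that by (auto simp: raise_def)
      then show ?thesis using comp[OF raise raise] by (intro bexI[of _ "raise m \<circ> raise m"]) simp_all
    next
      case i: False
      \<comment> \<open>\<open>?s\<close> sends middle states with value \<open>f 0\<close> to the
        bottom and the other middle states to the top. Then \<open>raise m\<close> lifts the bottom
        to \<open>1\<close>, and the last map moves \<open>1\<close> to \<open>f 0\<close>.\<close>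
      let ?s = "\<lambda>q. if q \<in> {1..m} then (if f q = f 0 then 0 else m + 1) else q"
      have s: "?s \<in> H" by (rule inH) auto
      have f0: "f 0 \<in> {1..m}" using fQ[of 0] False i by auto
      have r: "id(1 := f 0) \<in> H" using f0 by (cases "f 0 = 1") (auto intro!: id inH)
      have "(id(1 := f 0) \<circ> (raise m \<circ> ?s)) q = f q" if q: "q \<le> m + 1" for q
      proof -
        consider "q = 0" | "q = m + 1" | "q \<in> {1..m}" using q by fastforce
        then show ?thesis using f0 fz two[OF q] by cases (auto simp: raise_def)
      qed
      then show ?thesis using comp[OF r comp[OF raise s]]
        by (intro bexI[of _ "id(1 := f 0) \<circ> (raise m \<circ> ?s)"]) simp_all
    qed
  qed
qed

end

section \<open>Ideals attaining the bound, and the upper bound\<close>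

text \<open>For \<open>m = 2\<close> the cycle equals the transposition, and for
  \<open>m = 1\<close> the collapse to the top is a product of the listed maps. For
  \<open>m \<le> 1\<close> the identity is listed because only nonempty words generate.\<close>

definition gens :: "nat \<Rightarrow> (nat \<Rightarrow> nat) list" where
  "gens m =
    (if m = 0 then [id, raise m]
     else if m = 1 then [id, id(1 := 0), raise m]
     else if m = 2 then [swp 1 2, id(1 := 0), id(1 := m + 1), id(1 := 2), raise m]
     else [cyc m, swp 1 2, id(1 := 0), id(1 := m + 1), id(1 := 2), raise m])"

lemma length_gens: "length (gens m) = min_alpha (m + 2)"
  by (simp add: gens_def min_alpha_def)

lemma (in comp_closed) gens_generate:
  assumes "set (gens m) \<subseteq> H" "f \<in> maxmaps {..m + 1} 0 (m + 1)"
  shows "\<exists>h\<in>H. \<forall>q\<in>{..m + 1}. h q = f q"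
proof -
  have r: "raise m \<in> H" using assms(1) by (auto simp: gens_def split: if_splits)
  consider "m = 0" | "m = 1" | "m \<ge> 2" by linarith
  then show ?thesis
  proof cases
    case 1
    then show ?thesis using assms r by (intro maxmaps_in) (auto simp: gens_def)
  next
    case 2
    then have H: "id \<in> H" "id(1 := 0) \<in> H" using assms(1) by (auto simp: gens_def)
    have tr: "swp x y \<in> H" if "x \<in> {1..m}" "y \<in> {1..m}" for x y
      using that 2 H by (simp add: le_antisym)
    \<comment> \<open>The bottom is lifted to \<open>1\<close> and brought back, while the only
      middle state reaches the top.\<close>
    have "id(1 := 0) \<circ> raise m = id(1 := m + 1)"
      using 2 by (auto simp: raise_def fun_eq_iff)
    then have "id(1 := m + 1) \<in> H" using comp[OF H(2) r] by simp
    then show ?thesis using 2 H tr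
      by (intro maxmaps_in[OF H(1) tr collapses_in r assms(2)]) auto
  next
    case 3
    have c2: "cyc 2 = swp 1 2" by (auto simp: cyc_def fun_eq_iff Transposition.transpose_def)
    have H: "swp 1 2 \<in> H" "id(1 := 0) \<in> H" "id(1 := m + 1) \<in> H" "id(1 := 2) \<in> H" "cyc m \<in> H"
      using assms(1) 3 c2 by (auto simp: gens_def split: if_splits)
    have tr: "swp x y \<in> H" if "x \<in> {1..m}" "y \<in> {1..m}" for x y
      by (rule transposes_in[OF H(5,1) 3 that])
    have "swp 1 1 \<in> H" by (rule tr) (use 3 in simp_all)
    then have "id \<in> H" by simp
    then show ?thesis
      by (intro maxmaps_in[OF _ tr collapses_in[OF tr H(2,3,4)] r assms(2)])
  qed
qed

text \<open>This restates membership in \<open>maxmaps\<close> for total maps, so that they compose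
  without restrictions.\<close>

definition admissible :: "nat \<Rightarrow> (nat \<Rightarrow> nat) \<Rightarrow> bool" where
  "admissible m h \<longleftrightarrow> h (m + 1) = m + 1 \<and> (\<forall>q\<le>m + 1. h q \<le> m + 1) \<and>
    (h 0 = 0 \<or> (\<forall>q\<le>m + 1. h q = h 0 \<or> h q = m + 1))"

lemma admissible_comp:
  assumes f: "admissible m f" and g: "admissible m g"
  shows "admissible m (g \<circ> f)"
proof -
  have z: "f (m + 1) = m + 1" "g (m + 1) = m + 1"
    and Q: "\<And>q. q \<le> m + 1 \<Longrightarrow> f q \<le> m + 1" "\<And>q. q \<le> m + 1 \<Longrightarrow> g q \<le> m + 1"
    using assms unfolding admissible_def by blast+
  have "g (f 0) = 0 \<or> (\<forall>q\<le>m + 1. g (f q) = g (f 0) \<or> g (f q) = m + 1)"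
  proof (cases "f 0 = 0")
    case True
    have "g 0 = 0 \<or> (\<forall>q\<le>m + 1. g q = g 0 \<or> g q = m + 1)"
      using g unfolding admissible_def by blast
    then show ?thesis unfolding True using Q(1) by blast
  next
    case False
    then have two: "\<forall>q\<le>m + 1. f q = f 0 \<or> f q = m + 1"
      using f unfolding admissible_def by simp
    have "g (f q) = g (f 0) \<or> g (f q) = m + 1" if "q \<le> m + 1" for q
      using two[rule_format, OF that] z(2) by (elim disjE) simp_all
    then show ?thesis by blast
  qed
  then show ?thesis using z Q unfolding admissible_def by simp
qed

lemma admissible_gens:
  assumes "h \<in> set (gens m)"
  shows "admissible m h"
proof -
  have "admissible m (raise m)" "admissible m (cyc m)" "admissible m id"
    by (simp_all add: admissible_def raise_def cyc_def)
  moreover have "admissible m (swp 1 2)" if "m \<ge> 2"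
    using that by (simp add: admissible_def Transposition.transpose_def)
  moreover have "admissible m (id(1 := v))" if "m \<ge> 1" "v \<le> m + 1" for v
    using that by (simp add: admissible_def)
  ultimately show ?thesis
    using assms unfolding gens_def by (simp split: if_splits) fastforce+
qed

lemma admissible_iff_maxmaps: "admissible m h \<longleftrightarrow> restrict h {..m + 1} \<in> maxmaps {..m + 1} 0 (m + 1)"
  unfolding admissible_def maxmaps_def by (auto simp: restrict_PiE_iff)

section \<open>An automaton attaining the bound\<close>

lemma ex_ideal_attaining_bound:
  fixes A :: "'a set"
  assumes "finite A" "n > 1" "card A \<ge> min_alpha n"
  shows "\<exists>L. L \<subseteq> lists A \<and> two_sided_ideal A L \<and> kappa A L = n \<and> sigma A L = sigma_bound n"
proof -
  define m where "m = n - 2"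
  have n: "n = m + 2" using assms by (simp add: m_def)
  have "card (set (gens m)) \<le> card A"
    using card_length[of "gens m"] assms(3) by (simp add: length_gens n)
  then obtain j where "inj_on j (set (gens m))" "j ` set (gens m) \<subseteq> A"
    using card_le_inj[of "set (gens m)" A] assms(1) by blast
  moreover have "set (gens m) \<noteq> {}" by (simp add: gens_def)
  \<comment> \<open>Surplus letters of a larger alphabet repeat generators.\<close>
  ultimately obtain act where act: "act ` A = set (gens m)"
    using inj_on_iff_surj[of "set (gens m)" A] by blast
  define run where "run = fold act"
  let ?z = "m + 1" and ?Q = "{..m + 1}"
  have run_Nil: "run [] q = q" for q by (simp add: run_def)
  have run_append: "run (u @ v) q = run v (run u q)" for u v q by (simp add: run_def)
  have adm: "admissible m (run w)" if "w \<in> lists A" for w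
    using that
  proof (induction w)
    case Nil
    then show ?case by (simp add: run_def admissible_def)
  next
    case (Cons a w)
    have "run (a # w) = run w \<circ> act a" by (simp add: run_def)
    moreover have "admissible m (act a)" using Cons act by (intro admissible_gens) auto
    moreover have "admissible m (run w)" using Cons by simp
    ultimately show ?case using admissible_comp by metis
  qed
  define H where "H = run ` (lists A - {[]})"
  interpret comp_closed H m
  proof
    fix f g assume "f \<in> H" "g \<in> H"
    then obtain u v where "u \<in> lists A - {[]}" "v \<in> lists A - {[]}" "f = run u" "g = run v"
      unfolding H_def by blast
    moreover from this have "f \<circ> g = run (v @ u)" by (simp add: fun_eq_iff run_append)
    ultimately show "f \<circ> g \<in> H" unfolding H_def by auto
  qed
  have "set (gens m) \<subseteq> H"
  proof
    fix g assume "g \<in> set (gens m)"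
    then obtain a where "a \<in> A" "g = run [a]" using act by (auto simp: run_def)
    then show "g \<in> H" unfolding H_def by auto
  qed
  note gen = gens_generate[OF this]
  have ex_word: "\<exists>w\<in>lists A - {[]}. \<forall>q\<le>m + 1. run w q = g q" if "admissible m g" for g
    using gen[of "restrict g ?Q"] that unfolding H_def admissible_iff_maxmaps by auto
  define L where "L = {w \<in> lists A. run w 0 = ?z}"
  interpret M: minimal_dfa A L ?Q 0 run "\<lambda>q. {w \<in> lists A. run w q = ?z}"
  proof
    show "?Q = (\<lambda>w. run w 0) ` lists A"
    proof (intro equalityI subsetI)
      fix i assume i: "i \<in> ?Q"
      show "i \<in> (\<lambda>w. run w 0) ` lists A"
      proof (cases "i = 0")
        case True
        then show ?thesis by (intro image_eqI[of _ _ "[]"]) (auto simp: run_Nil)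
      next
        case False
        have "admissible m (\<lambda>q. if q = 0 then i else ?z)"
          using i by (auto simp: admissible_def)
        from ex_word[OF this] obtain w where w: "w \<in> lists A"
          "\<forall>q\<le>m + 1. run w q = (if q = 0 then i else ?z)" by blast
        then have "i = run w 0" by simp
        then show ?thesis using w(1) by (rule image_eqI)
      qed
    next
      fix i assume "i \<in> (\<lambda>w. run w 0) ` lists A"
      then show "i \<in> ?Q" using adm unfolding admissible_def by fastforce
    qed
    show "inj_on (\<lambda>q. {w \<in> lists A. run w q = ?z}) ?Q"
    proof -
      have key: "p = q" if "p \<in> ?Q" "q \<in> ?Q" "q \<noteq> 0"
        and e: "{w \<in> lists A. run w p = ?z} = {w \<in> lists A. run w q = ?z}" for p q
      proof -
        have "[] \<in> {w \<in> lists A. run w p = ?z} \<longleftrightarrow> [] \<in> {w \<in> lists A. run w q = ?z}"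
          by (simp only: e)
        then have "p = ?z \<longleftrightarrow> q = ?z" by (simp add: run_Nil)
        \<comment> \<open>A word collapsing \<open>q\<close> into the top and fixing all other
          states separates \<open>q\<close> from every other state but the top; the empty word
          handles the top.\<close>
        moreover have "admissible m (id(q := ?z))"
          using that by (auto simp: admissible_def)
        from ex_word[OF this] obtain w where w: "w \<in> lists A" "\<forall>x\<le>m + 1. run w x = (id(q := ?z)) x"
          by blast
        then have "run w q = ?z" using that by simp
        then have "run w p = ?z" using e w by blast
        then have "p = q \<or> p = ?z" using w that by (auto split: if_splits)
        ultimately show ?thesis by blast
      qed
      show ?thesis
      proof (rule inj_onI)
        fix p q assume "p \<in> ?Q" "q \<in> ?Q"
          "{w \<in> lists A. run w p = ?z} = {w \<in> lists A. run w q = ?z}"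
        then show "p = q" using key[of p q] key[of q p] by (cases "q = 0"; cases "p = 0") auto
      qed
    qed
  qed (auto simp: L_def run_Nil run_append quotient_lang_def)
  have "two_sided_ideal A L"
    unfolding two_sided_ideal_def
  proof (intro conjI equalityI subsetI)
    have "admissible m (\<lambda>_. ?z)" by (simp add: admissible_def)
    from ex_word[OF this] obtain w where "w \<in> lists A" "\<forall>q\<le>m + 1. run w q = ?z" by blast
    then have "w \<in> L" by (simp add: L_def)
    then show "L \<noteq> {}" by blast
    fix w assume "w \<in> L"
    then have "w = [] @ w @ [] \<and> [] \<in> lists A \<and> w \<in> L \<and> [] \<in> lists A" by simp
    then show "w \<in> {u @ w @ v |u w v. u \<in> lists A \<and> w \<in> L \<and> v \<in> lists A}" by blast
  next
    fix x assume "x \<in> {u @ w @ v |u w v. u \<in> lists A \<and> w \<in> L \<and> v \<in> lists A}"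
    then obtain u w v where x: "x = u @ w @ v" "u \<in> lists A" "w \<in> L" "v \<in> lists A" by blast
    then have w: "w \<in> lists A" "run w 0 = ?z" by (auto simp: L_def)
    have "run u 0 \<le> ?z" using adm[OF x(2)] by (auto simp: admissible_def)
    \<comment> \<open>An admissible map sending \<open>0\<close> to the top sends every state there,
      because its only possible values coincide.\<close>
    then have "run w (run u 0) = ?z" using adm[OF w(1)] w(2) by (auto simp: admissible_def)
    moreover have "run v ?z = ?z" using adm[OF x(4)] by (auto simp: admissible_def)
    ultimately show "x \<in> L" using x w by (auto simp: L_def run_append)
  qed
  moreover have "M.trans ` (lists A - {[]}) = maxmaps ?Q 0 ?z"
  proof (intro equalityI subsetI)
    fix f assume "f \<in> M.trans ` (lists A - {[]})"
    then show "f \<in> maxmaps ?Q 0 ?z" using adm unfolding M.trans_def admissible_iff_maxmaps by blast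
  next
    fix f assume f: "f \<in> maxmaps ?Q 0 ?z"
    then obtain w where w: "w \<in> lists A - {[]}" "\<forall>q\<in>?Q. run w q = f q"
      using gen[OF f] unfolding H_def by blast
    have "f = M.trans w"
      unfolding M.trans_def by (rule extensionalityI[of _ ?Q]) (use f w in \<open>auto simp: maxmaps_def PiE_iff\<close>)
    then show "f \<in> M.trans ` (lists A - {[]})" using w by blast
  qed
  then have "sigma A L = sigma_bound n"
    using M.sigma_eq card_maxmaps[of ?Q 0 ?z] by (simp add: n)
  moreover have "kappa A L = n" using M.kappa_eq by (simp add: n)
  moreover have "L \<subseteq> lists A" by (rule M.L_subset)
  ultimately show ?thesis by blast
qed

section \<open>Upper bound and necessary alphabet size for ideals\<close>

lemma ideal_bounds:
  fixes A :: "'a set"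
  assumes "finite A" "L \<subseteq> lists A" "kappa A L = n" "n > 1" "two_sided_ideal A L"
  shows "sigma A L \<le> sigma_bound n" "card A < min_alpha n \<Longrightarrow> sigma A L < sigma_bound n"
proof -
  let ?Q = "(\<lambda>w. quotient_lang w L) ` lists A"
  interpret minimal_dfa A L ?Q L quotient_lang "\<lambda>K. K"
    by (rule minimal_dfa_quotients[OF assms(2)])
  have cQ: "card ?Q = n" using kappa_eq assms(3) by simp
  then have finQ: "finite ?Q" using assms(4) by (metis card.infinite not_one_less_zero)
  note mult = two_sided_ideal_mult[OF assms(5)]
  have sub: "K \<subseteq> lists A" if "K \<in> ?Q" for K
    using that quotient_lang_subset[OF _ assms(2)] by blast
  have bot: "L \<subseteq> K" if "K \<in> ?Q" for K
    using that mult[of _ _ "[]"] by (auto simp: quotient_lang_def)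
  obtain w where w: "w \<in> L" using assms(5) by (auto simp: two_sided_ideal_def)
  have "quotient_lang w L = lists A"
    using mult[of "[]" w] w sub[of "quotient_lang w L"] assms(2) by (auto simp: quotient_lang_def)
  then have topQ: "lists A \<in> ?Q" using w assms(2) by blast
  have ne: "L \<noteq> lists A"
  proof
    assume "L = lists A"
    then have "?Q \<subseteq> {lists A}" using bot sub by blast
    then have "card ?Q \<le> 1" using card_mono[of "{lists A}" ?Q] by simp
    with cQ assms(4) show False by simp
  qed
  let ?T = "trans ` (lists A - {[]})"
  have T: "?T \<subseteq> monomaps ?Q (lists A)"
  proof
    fix f assume "f \<in> ?T"
    then obtain w where w: "w \<in> lists A" "f = restrict (quotient_lang w) ?Q"
      by (auto simp: trans_def)
    have "quotient_lang w (lists A) = lists A" using w by (auto simp: quotient_lang_def)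
    moreover have "quotient_lang w K \<in> ?Q" if "K \<in> ?Q" for K using run_in_Q[OF w(1) that] .
    moreover have "quotient_lang w K \<subseteq> quotient_lang w K'" if "K \<subseteq> K'" for K K'
      using that by (auto simp: quotient_lang_def)
    ultimately show "f \<in> monomaps ?Q (lists A)"
      using topQ unfolding monomaps_def w(2) by (simp add: restrict_PiE_iff)
  qed
  have finM: "finite (monomaps ?Q (lists A))" by (rule finite_monomaps[OF finQ])
  have finW: "finite (maxmaps ?Q L (lists A))"
    unfolding maxmaps_def by (rule finite_subset[OF _ finite_PiE[of ?Q "\<lambda>_. ?Q"]]) (use finQ in auto)
  have cW: "card (maxmaps ?Q L (lists A)) = sigma_bound n"
    using card_maxmaps[OF finQ s0_in_Q topQ ne] cQ by simp
  have alt: "monomaps ?Q (lists A) \<subseteq> maxmaps ?Q L (lists A) \<or> card (monomaps ?Q (lists A)) < sigma_bound n"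
    using card_monomaps_le_cases[OF finQ s0_in_Q bot topQ sub ne] cQ by simp
  have le: "card ?T \<le> card (monomaps ?Q (lists A))" by (rule card_mono[OF finM T])
  show bound: "sigma A L \<le> sigma_bound n"
    using alt le card_mono[OF finW, of ?T] T cW sigma_eq by fastforce
  show "sigma A L < sigma_bound n" if "card A < min_alpha n"
  proof (rule ccontr)
    assume "\<not> sigma A L < sigma_bound n"
    then have eq: "card ?T = sigma_bound n" using bound sigma_eq by simp
    \<comment> \<open>Equality excludes the strict alternative. The transition maps then lie in
      \<open>maxmaps\<close> and fill it by cardinality, so the lower bound on the number of
      generators applies.\<close>
    then have "monomaps ?Q (lists A) \<subseteq> maxmaps ?Q L (lists A)" using alt le by linarith
    then have "?T \<subseteq> maxmaps ?Q L (lists A)" using T by blast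
    then have gen: "?T = maxmaps ?Q L (lists A)"
      using card_subset_eq[OF finW] eq cW by simp
    interpret maxmaps_generators A ?Q L "lists A" quotient_lang
      using assms(1) finQ s0_in_Q topQ ne gen
      by unfold_locales (auto simp: quotient_lang_append trans_def)
    show False using card_alphabet_ge that cQ by simp
  qed
qed

theorem theorem6:
  shows "(\<forall>(A :: 'a set) L n.
            finite A \<and> A \<noteq> {} \<and> L \<subseteq> lists A \<and> kappa A L = n \<and> n > 1 \<and>
            (two_sided_ideal A L \<or> factor_closed L)
            \<longrightarrow> sigma A L \<le> sigma_bound n)
       \<and> (\<forall>(A :: 'a set) n.
            finite A \<and> n > 1 \<and> card A \<ge> min_alpha n
            \<longrightarrow> (\<exists>L. L \<subseteq> lists A \<and> two_sided_ideal A L \<and>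
                     kappa A L = n \<and> sigma A L = sigma_bound n)
              \<and> (\<exists>L. L \<subseteq> lists A \<and> factor_closed L \<and>
                     kappa A L = n \<and> sigma A L = sigma_bound n))
       \<and> (\<forall>(A :: 'a set) L n.
            finite A \<and> A \<noteq> {} \<and> n > 1 \<and> card A < min_alpha n \<and>
            L \<subseteq> lists A \<and> kappa A L = n \<and>
            (two_sided_ideal A L \<or> factor_closed L)
            \<longrightarrow> sigma A L < sigma_bound n)"
proof -
  have ideal: "\<exists>L'\<subseteq>lists A. two_sided_ideal A L' \<and> kappa A L' = n \<and> sigma A L' = sigma A L"
    if "L \<subseteq> lists A" "kappa A L = n" "n > 1" "two_sided_ideal A L \<or> factor_closed L"
    for A :: "'a set" and L n
  proof (cases "two_sided_ideal A L")
    case True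
    then show ?thesis using that by (intro exI[of _ L]) simp
  next
    case False
    then have "two_sided_ideal A (lists A - L)"
      using that by (intro two_sided_ideal_compl) auto
    then show ?thesis
      using that kappa_compl[of L A] sigma_compl[of A L] by (intro exI[of _ "lists A - L"]) auto
  qed
  have tight: "\<exists>L. L \<subseteq> lists A \<and> factor_closed L \<and> kappa A L = n \<and> sigma A L = sigma_bound n"
    if h: "finite A" "n > 1" "card A \<ge> min_alpha n" for A :: "'a set" and n
  proof -
    obtain L where "L \<subseteq> lists A" "two_sided_ideal A L" "kappa A L = n" "sigma A L = sigma_bound n"
      using ex_ideal_attaining_bound[OF h] by blast
    then show ?thesis
      using factor_closed_compl[of A L] kappa_compl[of L A] sigma_compl[of A L]
      by (intro exI[of _ "lists A - L"]) auto
  qed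
  have bound: "sigma A L \<le> sigma_bound n \<and> (card A < min_alpha n \<longrightarrow> sigma A L < sigma_bound n)"
    if h: "finite A" "L \<subseteq> lists A" "kappa A L = n" "n > 1" "two_sided_ideal A L \<or> factor_closed L"
    for A :: "'a set" and L n
  proof -
    obtain L' where "L' \<subseteq> lists A" "two_sided_ideal A L'" "kappa A L' = n" "sigma A L' = sigma A L"
      using ideal[OF h(2-5)] by blast
    then show ?thesis using ideal_bounds[OF h(1) _ _ h(4), of L'] by simp
  qed
  show ?thesis
  proof (intro conjI allI impI; elim conjE)
    fix A :: "'a set" and L n
    assume "finite A" "L \<subseteq> lists A" "kappa A L = n" "n > 1"
      "two_sided_ideal A L \<or> factor_closed L"
    from bound[OF this] show "sigma A L \<le> sigma_bound n" ..
  next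
    fix A :: "'a set" and L n
    assume "finite A" "L \<subseteq> lists A" "kappa A L = n" "n > 1"
      "two_sided_ideal A L \<or> factor_closed L" and small: "card A < min_alpha n"
    from bound[OF this(1-5)] small show "sigma A L < sigma_bound n" by blast
  qed (rule ex_ideal_attaining_bound tight; assumption)+
qed

end
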